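(* Let $p\ge-1$ be an integer and $c>0$. For any non-negative integer $N$, any integer $n\ge1$, and all $r\in(0,1)$, $$L_{N,c}[\overline T_{N,n}](r)=a_n\overline T_{N,n-1}(r)+b_n\overline T_{N,n}(r)+c_n\overline T_{N,n+1}(r),$$ where $$a_n=\frac{-c^2(n+N+p/2)\,n}{(2n+N+p/2)\sqrt{2n+N+p/2+1}\,\sqrt{2n+N+p/2-1}},$$ $$b_n=\frac{-c^2(N+p/2)^2}{2(2n+N+p/2)(2n+N+p/2+2)}-\frac{c^2}{2}-\chi_{N,n},$$ $$c_n=\frac{-c^2(n+1+N+p/2)(n+1)}{(2n+N+p/2+2)\sqrt{2n+N+p/2+3}\,\sqrt{2n+N+p/2+1}},$$ and $\chi_{N,n}=(N+p/2+2n+1/2)(N+p/2+2n+3/2)$.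
   Context: Let $p\ge-1$ be an integer and $c>0$. For a non-negative integer $N$ the differential operator $L_{N,c}$ is $$L_{N,c}[\varphi](x)=\frac{d}{dx}\left((1-x^2)\frac{d\varphi}{dx}(x)\right)+\left(\frac{\frac14-(N+\frac p2)^2}{x^2}-c^2x^2\right)\varphi(x),\qquad 0<x<1.$$ The radial Zernike polynomials are $$R_{N,n}(r)=r^N\sum_{m=0}^n(-1)^m\binom{n+N+\frac p2}{m}\binom{n}{m}(r^2)^{n-m}(1-r^2)^m,$$ $\overline R_{N,n}(r)=\sqrt{2(2n+N+p/2+1)}\,R_{N,n}(r)$, and $\overline T_{N,n}(r)=r^{(p+1)/2}\,\overline R_{N,n}(r)$. *)

theory Defs
  imports "HOL-Analysis.Analysis"
begin

definition L_op :: "int \<Rightarrow> nat \<Rightarrow> real \<Rightarrow> (real \<Rightarrow> real) \<Rightarrow> real \<Rightarrow> real" where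
  "L_op p N c \<phi> x =
     deriv (\<lambda>y. (1 - y\<^sup>2) * deriv \<phi> y) x
     + ((1/4 - (real N + real_of_int p / 2)\<^sup>2) / x\<^sup>2 - c\<^sup>2 * x\<^sup>2) * \<phi> x"

(* The upper argument n + N + p/2 may be a half-integer, hence the generalized
   binomial coefficient. *)
definition radial_Zernike :: "int \<Rightarrow> nat \<Rightarrow> nat \<Rightarrow> real \<Rightarrow> real" where
  "radial_Zernike p N n r =
     r ^ N * (\<Sum>m=0..n. (- 1) ^ m * ((real n + real N + real_of_int p / 2) gchoose m)
                * real (n choose m) * (r\<^sup>2) ^ (n - m) * (1 - r\<^sup>2) ^ m)"

definition radial_Zernike_normalized :: "int \<Rightarrow> nat \<Rightarrow> nat \<Rightarrow> real \<Rightarrow> real" where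
  "radial_Zernike_normalized p N n r =
     sqrt (2 * (2 * real n + real N + real_of_int p / 2 + 1)) * radial_Zernike p N n r"

(* Only used for r > 0, where powr is the ordinary real power. *)
definition T_normalized :: "int \<Rightarrow> nat \<Rightarrow> nat \<Rightarrow> real \<Rightarrow> real" where
  "T_normalized p N n r =
     r powr ((real_of_int p + 1) / 2) * radial_Zernike_normalized p N n r"

definition chi :: "int \<Rightarrow> nat \<Rightarrow> nat \<Rightarrow> real" where
  "chi p N n = (real N + real_of_int p / 2 + 2 * real n + 1/2)
             * (real N + real_of_int p / 2 + 2 * real n + 3/2)"

definition coeff_a :: "int \<Rightarrow> real \<Rightarrow> nat \<Rightarrow> nat \<Rightarrow> real" where
  "coeff_a p c N n =
     (- c\<^sup>2 * (real n + real N + real_of_int p / 2) * real n)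
     / ((2 * real n + real N + real_of_int p / 2)
        * sqrt (2 * real n + real N + real_of_int p / 2 + 1)
        * sqrt (2 * real n + real N + real_of_int p / 2 - 1))"

definition coeff_b :: "int \<Rightarrow> real \<Rightarrow> nat \<Rightarrow> nat \<Rightarrow> real" where
  "coeff_b p c N n =
     (- c\<^sup>2 * (real N + real_of_int p / 2)\<^sup>2)
     / (2 * (2 * real n + real N + real_of_int p / 2)
          * (2 * real n + real N + real_of_int p / 2 + 2))
     - c\<^sup>2 / 2 - chi p N n"

definition coeff_c :: "int \<Rightarrow> real \<Rightarrow> nat \<Rightarrow> nat \<Rightarrow> real" where
  "coeff_c p c N n =
     (- c\<^sup>2 * (real n + 1 + real N + real_of_int p / 2) * (real n + 1))
     / ((2 * real n + real N + real_of_int p / 2 + 2)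
        * sqrt (2 * real n + real N + real_of_int p / 2 + 3)
        * sqrt (2 * real n + real N + real_of_int p / 2 + 1))"

end

theory Submission
  imports Defs
begin

text \<open>
  Put \<open>a = N + p/2\<close> and \<open>x = r\<^sup>2\<close>. The sum that defines the radial Zernike polynomial is a shifted
  Jacobi polynomial in \<open>x\<close>, so that \<open>T\<close> is, up to a constant, \<open>r powr (a + 1/2) * P n x\<close> with
  \<open>P n\<close> the Jacobi polynomial of parameters \<open>(0, a)\<close> at \<open>2 * x - 1\<close>. The operator splits
  into a part free of \<open>c\<close> and multiplication by \<open>- c\<^sup>2 * x\<close>.

  In the variable \<open>x\<close>, the part free of \<open>c\<close> is a hypergeometric operator
  (\<open>L_op_powr_times_poly\<close>): the exponent \<open>a + 1/2\<close> is a root of \<open>s * (s - 1) = a\<^sup>2 - 1/4\<close>, and this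
  cancels the singular term in \<open>1 / r\<^sup>2\<close>. The Jacobi differential equation
  (\<open>jacobi_poly_differential_equation\<close>) makes \<open>T\<close> an eigenfunction of this part, with eigenvalue
  \<open>- chi\<close>. Multiplication by \<open>x\<close> couples three consecutive degrees by the recurrence of the
  orthogonal polynomials (\<open>jacobi_poly_three_term\<close>), and the square roots in the coefficients only
  account for the normalization.

  Both facts about \<open>P n\<close> are read off from its coefficients in powers of \<open>x\<close>. These are
  single products of binomial coefficients (\<open>poly_jacobi_poly\<close>, by Vandermonde's identity), whose
  neighbours in \<open>n\<close> and \<open>k\<close> have rational ratios. Each of the two facts thus becomes a rational
  identity in \<open>n\<close>, \<open>k\<close> and \<open>a\<close>.
\<close>

section \<open>Shifted Jacobi polynomials\<close>

text \<open>
  This is the Jacobi polynomial of degree \<open>n\<close> with parameters \<open>(0, a)\<close>, evaluated at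
  \<open>2 * x - 1\<close>. It is given by its monomial coefficients because these satisfy
  two-term recurrences.
\<close>

definition jacobi_poly :: "real \<Rightarrow> nat \<Rightarrow> real poly" where
  "jacobi_poly a n =
     (\<Sum>k\<le>n. monom ((- 1) ^ (n + k) * real (n choose k) * ((real n + real k + a) gchoose n)) k)"

lemma coeff_jacobi_poly:
  "coeff (jacobi_poly a n) k =
     (- 1) ^ (n + k) * real (n choose k) * ((real n + real k + a) gchoose n)"
proof -
  have "coeff (jacobi_poly a n) k =
      (\<Sum>j\<le>n. if j = k then (- 1) ^ (n + j) * real (n choose j) * ((real n + real j + a) gchoose n) else 0)"
    unfolding jacobi_poly_def coeff_sum by (intro sum.cong) auto
  then show ?thesis
    by (simp add: sum.delta' binomial_eq_0)
qed

text \<open>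
  The product of the two ordinary binomial coefficients can be regrouped so that only one factor
  depends on \<open>m\<close>; the remaining sum is a Vandermonde convolution.
\<close>

lemma sum_gbinomial_binomial_binomial:
  fixes b :: real
  assumes "i \<le> n"
  shows "(\<Sum>m=0..n. (b gchoose m) * real (n choose m) * real (m choose i))
       = real (n choose i) * ((b + real (n - i)) gchoose n)"
proof -
  have "real (n choose m) * real (m choose i) = real (n choose i) * real ((n - i) choose (n - m))"
    if "m \<le> n" for m
  proof (cases "i \<le> m")
    case True
    have "(n choose m) * (m choose i) = (n choose i) * ((n - i) choose (m - i))"
      using choose_mult[OF True that] by simp
    also have "(n - i) choose (m - i) = (n - i) choose (n - m)"
      using binomial_symmetric[of "m - i" "n - i"] True that by simp
    finally show ?thesis
      by (metis of_nat_mult)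
  next
    case False
    then show ?thesis
      using assms that by (simp add: binomial_eq_0)
  qed
  then have "(\<Sum>m=0..n. (b gchoose m) * real (n choose m) * real (m choose i))
      = (\<Sum>m=0..n. real (n choose i) * ((b gchoose m) * (real (n - i) gchoose (n - m))))"
    by (intro sum.cong) (simp_all add: mult.assoc mult.left_commute binomial_gbinomial)
  then show ?thesis
    using gbinomial_Vandermonde[of b "real (n - i)" n]
    unfolding sum_distrib_left[symmetric] by simp
qed

text \<open>
  This links the monomial coefficients to the sum in the definition of the radial Zernike
  polynomials. Expanding \<open>(1 - x) ^ m\<close> and collecting the terms with \<open>x ^ (n - i)\<close> gives
  the preceding convolution, with \<open>b = n + a\<close>.
\<close>

lemma poly_jacobi_poly:
  "poly (jacobi_poly a n) x =
     (\<Sum>m=0..n. (- 1) ^ m * ((real n + a) gchoose m) * real (n choose m) * x ^ (n - m) * (1 - x) ^ m)"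
proof -
  have expand: "x ^ (n - m) * (1 - x) ^ m
      = (\<Sum>i=0..n. (- 1) ^ (m + i) * real (m choose i) * x ^ (n - i))"
    if "m \<le> n" for m
  proof -
    \<comment> \<open>The power of \<open>- x\<close> is \<open>m - i\<close>, so that the total degree \<open>n - i\<close> does not depend on \<open>m\<close>.\<close>
    have "(1 - x) ^ m = (1 + (- x)) ^ m"
      by simp
    also have "\<dots> = (\<Sum>i\<le>m. real (m choose i) * (- x) ^ (m - i))"
      by (subst binomial_ring) simp
    finally have "x ^ (n - m) * (1 - x) ^ m
        = (\<Sum>i\<le>m. x ^ (n - m) * (real (m choose i) * (- x) ^ (m - i)))"
      by (simp add: sum_distrib_left)
    also have "\<dots> = (\<Sum>i\<le>m. (- 1) ^ (m + i) * real (m choose i) * x ^ (n - i))"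
    proof (rule sum.cong)
      fix i assume "i \<in> {..m}"
      then have "x ^ (n - i) = x ^ (n - m) * x ^ (m - i)"
        using that by (simp flip: power_add)
      moreover have "(- x) ^ (m - i) = (- 1) ^ (m + i) * x ^ (m - i)"
        using \<open>i \<in> {..m}\<close> by (simp add: power_minus' minus_one_power_iff power_minus[of x])
      ultimately show "x ^ (n - m) * (real (m choose i) * (- x) ^ (m - i))
          = (- 1) ^ (m + i) * real (m choose i) * x ^ (n - i)"
        by simp
    qed simp
    also have "\<dots> = (\<Sum>i=0..n. (- 1) ^ (m + i) * real (m choose i) * x ^ (n - i))"
      using that by (intro sum.mono_neutral_left) (auto simp: binomial_eq_0)
    finally show ?thesis .
  qed
  have "(\<Sum>m=0..n. (- 1) ^ m * ((real n + a) gchoose m) * real (n choose m) * x ^ (n - m) * (1 - x) ^ m)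
      = (\<Sum>m=0..n. \<Sum>i=0..n. (- 1) ^ i * x ^ (n - i) *
           (((real n + a) gchoose m) * real (n choose m) * real (m choose i)))"
  proof (rule sum.cong)
    fix m assume "m \<in> {0..n}"
    then have "(- 1) ^ m * ((real n + a) gchoose m) * real (n choose m) * x ^ (n - m) * (1 - x) ^ m
      = (- 1) ^ m * ((real n + a) gchoose m) * real (n choose m) *
        (\<Sum>i=0..n. (- 1) ^ (m + i) * real (m choose i) * x ^ (n - i))"
      using expand[of m] by (simp add: mult.assoc)
    also have "\<dots> = (\<Sum>i=0..n. ((- 1) ^ m * (- 1) ^ m) * ((- 1) ^ i * x ^ (n - i) *
           (((real n + a) gchoose m) * real (n choose m) * real (m choose i))))"
      unfolding sum_distrib_left power_add by (intro sum.cong) (simp_all only: ac_simps)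
    finally show "(- 1) ^ m * ((real n + a) gchoose m) * real (n choose m) * x ^ (n - m) * (1 - x) ^ m
      = (\<Sum>i=0..n. (- 1) ^ i * x ^ (n - i) *
           (((real n + a) gchoose m) * real (n choose m) * real (m choose i)))"
      by (simp flip: power_mult_distrib)
  qed simp
  also have "\<dots> = (\<Sum>i=0..n. (- 1) ^ i * x ^ (n - i) *
      (\<Sum>m=0..n. ((real n + a) gchoose m) * real (n choose m) * real (m choose i)))"
    by (subst sum.swap) (simp add: sum_distrib_left)
  also have "\<dots> = (\<Sum>i=0..n. (- 1) ^ i * x ^ (n - i) *
      (real (n choose i) * ((real n + a + real (n - i)) gchoose n)))"
    by (intro sum.cong) (simp_all add: sum_gbinomial_binomial_binomial)
  also have "\<dots> = (\<Sum>k=0..n. (- 1) ^ (n - k) * x ^ k *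
      (real (n choose k) * ((real n + a + real k) gchoose n)))"
    by (subst sum.atLeastAtMost_rev) (auto intro!: sum.cong simp flip: binomial_symmetric)
  also have "\<dots> = (\<Sum>k\<le>n. (- 1) ^ (n + k) * real (n choose k) * ((real n + real k + a) gchoose n) * x ^ k)"
    unfolding atLeast0AtMost
    by (intro sum.cong) (auto simp: minus_one_power_iff add_ac)
  also have "\<dots> = poly (jacobi_poly a n) x"
    unfolding jacobi_poly_def by (simp add: poly_sum poly_monom)
  finally show ?thesis ..
qed

section \<open>The Jacobi differential equation\<close>

text \<open>
  Both factors of the coefficient change by an absorption identity when \<open>k\<close> grows by one. This is
  the recurrence of a terminating hypergeometric series, and the differential equation is its
  translation to the generating polynomial.
\<close>

lemma coeff_jacobi_poly_Suc:
  "(real k + 1) * (real k + a + 1) * coeff (jacobi_poly a n) (Suc k) =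
     - (real n - real k) * (real n + real k + a + 1) * coeff (jacobi_poly a n) k"
proof -
  have binom: "(real k + 1) * real (n choose Suc k) = (real n - real k) * real (n choose k)"
  proof (cases "k \<le> n")
    case True
    have "Suc k * (n choose Suc k) = (n - k) * (n choose k)"
      by (metis binomial_absorb_comp binomial_absorption)
    then have "real (Suc k * (n choose Suc k)) = real ((n - k) * (n choose k))"
      by presburger
    then show ?thesis
      using True by (simp add: algebra_simps)
  qed (simp add: binomial_eq_0)
  have gbinom: "(real k + a + 1) * ((real n + real (Suc k) + a) gchoose n)
      = (real n + real k + a + 1) * ((real n + real k + a) gchoose n)"
    using gbinomial_absorb_comp[of "real n + real (Suc k) + a" n]
    by (simp add: algebra_simps)
  have "(real k + 1) * (real k + a + 1) * coeff (jacobi_poly a n) (Suc k)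
      = (- 1) ^ (n + Suc k) * ((real k + 1) * real (n choose Suc k))
        * ((real k + a + 1) * ((real n + real (Suc k) + a) gchoose n))"
    unfolding coeff_jacobi_poly by (simp only: ac_simps)
  also have "\<dots> = (- 1) ^ (n + Suc k) * ((real n - real k) * real (n choose k))
        * ((real n + real k + a + 1) * ((real n + real k + a) gchoose n))"
    unfolding binom gbinom ..
  finally show ?thesis
    by (simp add: coeff_jacobi_poly algebra_simps)
qed

lemma jacobi_poly_differential_equation:
  fixes a x :: real and n :: nat
  defines "g \<equiv> jacobi_poly a n"
  shows "x * (1 - x) * poly (pderiv (pderiv g)) x + (a + 1 - (a + 2) * x) * poly (pderiv g) x
           = - (real n * (real n + a + 1)) * poly g x"
proof -
  have "[:0, 1, -1:] * pderiv (pderiv g) + [:a + 1, - (a + 2):] * pderiv g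
      = smult (- (real n * (real n + a + 1))) g"
  proof (rule poly_eqI)
    fix k
    \<comment> \<open>The first two coefficients are separate cases: there \<open>coeff_pCons\<close> yields zeros.\<close>
    show "coeff ([:0, 1, -1:] * pderiv (pderiv g) + [:a + 1, - (a + 2):] * pderiv g) k
        = coeff (smult (- (real n * (real n + a + 1))) g) k"
      using coeff_jacobi_poly_Suc[of k a n] unfolding g_def[symmetric]
      by (cases k; cases "k - 1")
         (simp_all add: coeff_pderiv coeff_pCons algebra_simps)
  qed
  then have "poly ([:0, 1, -1:] * pderiv (pderiv g) + [:a + 1, - (a + 2):] * pderiv g) x
      = poly (smult (- (real n * (real n + a + 1))) g) x"
    by simp
  then show ?thesis
    by (simp add: algebra_simps)
qed


section \<open>The three-term recurrence\<close>

text \<open>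
  With Pochhammer symbols the coefficients for different \<open>n\<close> but equal \<open>k\<close> share the starting
  point \<open>k + a + 1\<close>, and hence a common factor.
\<close>

lemma coeff_jacobi_poly_pochhammer:
  "coeff (jacobi_poly a n) k =
     (- 1) ^ (n + k) * real (n choose k) * (pochhammer (real k + a + 1) n / fact n)"
  unfolding coeff_jacobi_poly gbinomial_pochhammer' by (simp add: algebra_simps)

lemma of_nat_binomial_absorb_comp:
  "(real (Suc n) - real k) * real (Suc n choose k) = real (Suc n) * real (n choose k)"
proof (cases "k \<le> Suc n")
  case True
  have "real ((Suc n - k) * (Suc n choose k)) = real (Suc n * (n choose k))"
    using binomial_absorb_comp[of "Suc n" k] by simp
  then show ?thesis
    by (simp only: of_nat_mult of_nat_diff[OF True])
qed (simp add: binomial_eq_0)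

text \<open>
  The four binomial coefficients that occur in the recurrence are polynomial multiples of one
  quantity \<open>W\<close>. The denominator of \<open>W\<close> is taken from the largest of the four, so the polynomial
  factors vanish exactly where a binomial coefficient is out of range, and \<open>k = n + 1\<close> and
  \<open>k = n + 2\<close> need no separate treatment.
\<close>

lemma binomial_common_factor:
  assumes "k \<le> n + 2"
  defines "W \<equiv> fact n / (fact k * fact (n + 2 - k)) :: real"
  shows "real (n choose k) = (real n + 2 - real k) * (real n + 1 - real k) * W"
    and "real (Suc n choose k) = (real n + 1) * (real n + 2 - real k) * W"
    and "real (Suc (Suc n) choose k) = (real n + 2) * (real n + 1) * W"
    and "k = Suc j \<Longrightarrow> real (Suc n choose j) = (real n + 1) * real k * W"
proof -
  have pos: "real n + 1 \<noteq> 0" "real n + 2 \<noteq> 0"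
    by simp_all
  have fact2: "fact (Suc (Suc n)) = (real n + 2) * (real n + 1) * fact n"
    by (simp add: algebra_simps)
  have *: "real (Suc (Suc n) choose k) = (real n + 2) * (real n + 1) * W"
    using assms binomial_fact[of k "Suc (Suc n)", where 'a = real] fact2 by simp
  show "real (Suc (Suc n) choose k) = (real n + 2) * (real n + 1) * W"
    by (rule *)
  have "(real n + 2 - real k) * real (Suc (Suc n) choose k) = (real n + 2) * real (Suc n choose k)"
    using of_nat_binomial_absorb_comp[of "Suc n" k] by (simp add: algebra_simps del: binomial_Suc_Suc)
  then have **: "real (Suc n choose k) = (real n + 1) * (real n + 2 - real k) * W"
    unfolding * using pos by algebra
  show "real (Suc n choose k) = (real n + 1) * (real n + 2 - real k) * W"
    by (rule **)
  show "real (n choose k) = (real n + 2 - real k) * (real n + 1 - real k) * W"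
  proof -
    have "(real n + 1 - real k) * real (Suc n choose k) = (real n + 1) * real (n choose k)"
      using of_nat_binomial_absorb_comp[of n k] by (simp add: algebra_simps del: binomial_Suc_Suc)
    then show ?thesis
      unfolding ** using pos by algebra
  qed
  show "real (Suc n choose j) = (real n + 1) * real k * W" if "k = Suc j"
  proof -
    have "real (Suc j * (Suc (Suc n) choose Suc j)) = real (Suc (Suc n) * (Suc n choose j))"
      by (simp only: Suc_times_binomial)
    then have "real k * real (Suc (Suc n) choose k) = (real n + 2) * real (Suc n choose j)"
      unfolding that of_nat_mult by simp
    then show ?thesis
      unfolding * using pos by algebra
  qed
qed

text \<open>
  In the coefficient of \<open>x ^ k\<close>, all four terms are polynomial multiples of one number \<open>u\<close>.
  Dividing by it leaves an identity between rational functions of \<open>n\<close>, \<open>k\<close> and \<open>a\<close>. The lower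
  index is \<open>n\<close> and the middle one \<open>Suc n\<close>; with \<open>a > -1\<close> this keeps the denominators positive.
\<close>

lemma jacobi_poly_three_term:
  fixes a x :: real and n :: nat
  defines "t \<equiv> 2 * real (Suc n) + a"
  assumes "a > -1"
  shows "x * poly (jacobi_poly a (Suc n)) x =
      (real n + 1) * (real n + 1 + a) / (t * (t + 1)) * poly (jacobi_poly a n) x
    + (a\<^sup>2 / (2 * t * (t + 2)) + 1/2) * poly (jacobi_poly a (Suc n)) x
    + (real n + 2) * (real n + 2 + a) / ((t + 1) * (t + 2)) * poly (jacobi_poly a (Suc (Suc n))) x"
proof -
  define A where "A = (real n + 1) * (real n + 1 + a) / (t * (t + 1))"
  define B where "B = a\<^sup>2 / (2 * t * (t + 2)) + 1/2"
  define C where "C = (real n + 2) * (real n + 2 + a) / ((t + 1) * (t + 2))"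
  have t: "t > 0" "t = 2 * real n + 2 + a"
    using assms by simp_all
  have "pCons 0 (jacobi_poly a (Suc n)) =
      smult A (jacobi_poly a n) + smult B (jacobi_poly a (Suc n)) + smult C (jacobi_poly a (Suc (Suc n)))"
  proof (rule poly_eqI)
    fix k
    let ?q = "\<lambda>m. coeff (jacobi_poly a m) k"
    have "coeff (pCons 0 (jacobi_poly a (Suc n))) k = A * ?q n + B * ?q (Suc n) + C * ?q (Suc (Suc n))"
    proof (cases "k \<le> n + 2")
      case False
      then show ?thesis
        by (cases k) (simp_all add: coeff_jacobi_poly binomial_eq_0)
    next
      case True
      define W :: real where "W = fact n / (fact k * fact (n + 2 - k))"
      define V :: real where "V = pochhammer (real k + a + 1) n / fact (Suc n)"
      define u where "u = (- 1) ^ (n + k) * W * V"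
      note binom = binomial_common_factor[OF True, folded W_def]
      have fact_neq: "real n + 1 \<noteq> 0" "real n + 2 \<noteq> 0" "fact n \<noteq> (0 :: real)"
        by simp_all
      have fact_Suc_real: "fact (Suc n) = (real n + 1) * fact n"
        "fact (Suc (Suc n)) = (real n + 2) * ((real n + 1) * fact n)"
        by (simp_all add: algebra_simps)
      have poch: "pochhammer (real k + a + 1) n / fact n = (real n + 1) * V"
        "pochhammer (real k + a + 1) (Suc n) / fact (Suc n) = (real k + a + 1 + real n) * V"
        "pochhammer (real k + a + 1) (Suc (Suc n)) / fact (Suc (Suc n))
           = (real k + a + 1 + real n) * (real k + a + 2 + real n) / (real n + 2) * V"
        using fact_neq unfolding V_def fact_Suc_real by (simp_all add: pochhammer_Suc divide_simps)
      have q: "?q n = (real n + 2 - real k) * (real n + 1 - real k) * (real n + 1) * u"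
        "?q (Suc n) = - ((real n + 1) * (real n + 2 - real k) * (real k + a + 1 + real n)) * u"
        "?q (Suc (Suc n)) = (real n + 1) * (real k + a + 1 + real n) * (real k + a + 2 + real n) * u"
        unfolding coeff_jacobi_poly_pochhammer binom poch u_def by simp_all
      have shifted: "coeff (pCons 0 (jacobi_poly a (Suc n))) k = (real n + 1) * real k * (real k + a) * u"
      proof (cases k)
        case (Suc j)
        have "pochhammer (real j + a + 1) (Suc n) / fact (Suc n) = (real k + a) * V"
          unfolding V_def pochhammer_rec using Suc by (simp add: algebra_simps)
        then show ?thesis
          using Suc binom(4)[OF Suc] unfolding u_def
          by (simp add: coeff_jacobi_poly_pochhammer del: binomial_Suc_Suc fact_Suc)
      qed simp
      \<comment> \<open>The recurrence after division by \<open>(n + 1) * u\<close>. Writing \<open>a\<close> in terms of \<open>t\<close> makes the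
        denominators polynomials in \<open>t\<close> alone.\<close>
      have "real k * (real k + a) =
          A * ((real n + 2 - real k) * (real n + 1 - real k))
        - B * ((real n + 2 - real k) * (real k + a + 1 + real n))
        + C * ((real k + a + 1 + real n) * (real k + a + 2 + real n))"
      proof -
        have a: "a = t - 2 * real n - 2"
          using t by simp
        have "t \<noteq> 0" "t + 1 \<noteq> 0" "t + 2 \<noteq> 0"
          using t(1) by simp_all
        then show ?thesis
          unfolding A_def B_def C_def a
          by (simp add: divide_simps) algebra
      qed
      then have "(real n + 1) * u * (real k * (real k + a)) = (real n + 1) * u *
         (A * ((real n + 2 - real k) * (real n + 1 - real k))
        - B * ((real n + 2 - real k) * (real k + a + 1 + real n))
        + C * ((real k + a + 1 + real n) * (real k + a + 2 + real n)))"
        by simp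
      then show ?thesis
        unfolding shifted q by (simp add: algebra_simps)
    qed
    then show "coeff (pCons 0 (jacobi_poly a (Suc n))) k =
        coeff (smult A (jacobi_poly a n) + smult B (jacobi_poly a (Suc n))
          + smult C (jacobi_poly a (Suc (Suc n)))) k"
      by simp
  qed
  then have "poly (pCons 0 (jacobi_poly a (Suc n))) x =
      poly (smult A (jacobi_poly a n) + smult B (jacobi_poly a (Suc n))
        + smult C (jacobi_poly a (Suc (Suc n)))) x"
    by simp
  then show ?thesis
    unfolding A_def B_def C_def by simp
qed

section \<open>The operator on powers times even polynomials\<close>

text \<open>
  Conjugation of the operator by \<open>r powr s\<close> followed by the substitution \<open>x = r\<^sup>2\<close>. The two
  derivatives of the power contribute \<open>s * (s - 1) / r\<^sup>2\<close>, which cancels against the potential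
  \<open>(1/4 - (N + p/2)\<^sup>2) / r\<^sup>2\<close>. The function has to be known on all positive reals, not only at
  \<open>r\<close>, because it is differentiated.
\<close>

lemma L_op_powr_times_poly:
  fixes g :: "real poly" and K r s :: real
  assumes r: "r > 0"
    and s: "s = real N + real_of_int p / 2 + 1/2"
    and \<phi>: "\<And>y. y > 0 \<Longrightarrow> \<phi> y = K * (y powr s * poly g (y\<^sup>2))"
  shows "L_op p N c \<phi> r = K * r powr s *
     (4 * (r\<^sup>2 * (1 - r\<^sup>2) * poly (pderiv (pderiv g)) (r\<^sup>2)
            + (s + 1/2 - (s + 3/2) * r\<^sup>2) * poly (pderiv g) (r\<^sup>2))
      - (s * (s + 1) + c\<^sup>2 * r\<^sup>2) * poly g (r\<^sup>2))"
proof -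
  have ev: "eventually (\<lambda>z. z > 0) (nhds y)" if "y > 0" for y :: real
    using that by (intro eventually_nhds_in_open[of "{0<..}", simplified]) auto
  define D where "D y = K * (y powr s * (s * poly g (y\<^sup>2) / y + 2 * y * poly (pderiv g) (y\<^sup>2)))" for y
  have D: "deriv \<phi> y = D y" if y: "y > 0" for y
  proof -
    have "((\<lambda>y. K * (y powr s * poly g (y\<^sup>2))) has_real_derivative D y) (at y)"
      unfolding D_def using y
      by (auto intro!: derivative_eq_intros poly_DERIV simp: powr_diff field_simps power2_eq_square)
    moreover have "deriv \<phi> y = deriv (\<lambda>y. K * (y powr s * poly g (y\<^sup>2))) y"
      by (rule deriv_cong_ev) (use ev[OF y] \<phi> in \<open>auto elim: eventually_mono\<close>)
    ultimately show ?thesis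
      by (simp add: DERIV_imp_deriv)
  qed
  \<comment> \<open>The derivative of \<open>(1 - y\<^sup>2) * D y\<close>, with \<open>K * r powr s / r\<^sup>2\<close> pulled out so that the rest is
    polynomial in \<open>r\<^sup>2\<close>.\<close>
  define E where "E = K * r powr s / r\<^sup>2 *
     ((s - 1) * (1 - r\<^sup>2) * (s * poly g (r\<^sup>2) + 2 * r\<^sup>2 * poly (pderiv g) (r\<^sup>2))
      + 2 * r\<^sup>2 * ((1 - r\<^sup>2) * ((s + 2) * poly (pderiv g) (r\<^sup>2) + 2 * r\<^sup>2 * poly (pderiv (pderiv g)) (r\<^sup>2))
         - (s * poly g (r\<^sup>2) + 2 * r\<^sup>2 * poly (pderiv g) (r\<^sup>2))))"
  have "((\<lambda>y. (1 - y\<^sup>2) * D y) has_real_derivative E) (at r)"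
    unfolding D_def E_def using r
    by (auto intro!: derivative_eq_intros poly_DERIV simp: powr_diff field_simps power2_eq_square)
  moreover have "deriv (\<lambda>y. (1 - y\<^sup>2) * deriv \<phi> y) r = deriv (\<lambda>y. (1 - y\<^sup>2) * D y) r"
    by (rule deriv_cong_ev) (use ev[OF r] D in \<open>auto elim: eventually_mono\<close>)
  ultimately have "deriv (\<lambda>y. (1 - y\<^sup>2) * deriv \<phi> y) r = E"
    by (simp add: DERIV_imp_deriv)
  moreover have "1/4 - (real N + real_of_int p / 2)\<^sup>2 = - s * (s - 1)"
    unfolding s by (simp add: power2_eq_square algebra_simps)
  ultimately have "L_op p N c \<phi> r =
      E + (- s * (s - 1) / r\<^sup>2 - c\<^sup>2 * r\<^sup>2) * (K * (r powr s * poly g (r\<^sup>2)))"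
    unfolding L_op_def using \<phi>[OF r] by simp
  moreover have "r\<^sup>2 \<noteq> 0"
    using r by simp
  ultimately show ?thesis
    unfolding E_def by (simp add: divide_simps) algebra
qed

section \<open>The three-term expansion\<close>

lemma T_normalized_eq_jacobi_poly:
  fixes p :: int and N n :: nat and r :: real
  assumes "r > 0"
  defines "a \<equiv> real N + real_of_int p / 2"
  shows "T_normalized p N n r =
    sqrt (2 * (2 * real n + a + 1)) * (r powr (a + 1/2) * poly (jacobi_poly a n) (r\<^sup>2))"
proof -
  have "r powr (a + 1/2) = r powr ((real_of_int p + 1) / 2) * r ^ N"
    using assms(1) unfolding a_def
    by (simp add: powr_add[symmetric] powr_realpow[symmetric] field_simps)
  then show ?thesis
    unfolding T_normalized_def radial_Zernike_normalized_def radial_Zernike_def poly_jacobi_poly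
    by (simp add: a_def add.assoc)
qed

theorem theorem3p5:
  fixes p :: int and c :: real and N n :: nat and r :: real
  assumes "p \<ge> - 1" and "c > 0" and "n \<ge> 1" and "r \<in> {0<..<1}"
  shows "L_op p N c (T_normalized p N n) r =
           coeff_a p c N n * T_normalized p N (n - 1) r
         + coeff_b p c N n * T_normalized p N n r
         + coeff_c p c N n * T_normalized p N (n + 1) r"
proof -
  define a where "a = real N + real_of_int p / 2"
  obtain m where n: "n = Suc m"
    using \<open>n \<ge> 1\<close> by (cases n) auto
  define t where "t = 2 * real n + a"
  define P where "P k = poly (jacobi_poly a k) (r\<^sup>2)" for k
  define K where "K = sqrt (2 * (t + 1))"
  define F where "F = r powr (a + 1/2)"
  have r: "r > 0"
    using assms by simp
  have a: "a \<ge> - 1/2"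
    using \<open>p \<ge> - 1\<close> unfolding a_def by simp
  have t: "t - 1 > 0" "t = 2 * real m + 2 + a"
    using a unfolding t_def n by simp_all
  have T: "T_normalized p N k r = sqrt 2 * sqrt (2 * real k + a + 1) * (F * P k)" for k
    using T_normalized_eq_jacobi_poly[OF r, of p N k]
    unfolding F_def P_def a_def real_sqrt_mult by (simp only: mult.assoc)

  have "L_op p N c (T_normalized p N n) r = K * F *
     (4 * (r\<^sup>2 * (1 - r\<^sup>2) * poly (pderiv (pderiv (jacobi_poly a n))) (r\<^sup>2)
            + (a + 1 - (a + 2) * r\<^sup>2) * poly (pderiv (jacobi_poly a n)) (r\<^sup>2))
      - ((a + 1/2) * (a + 3/2) + c\<^sup>2 * r\<^sup>2) * P n)"
    using L_op_powr_times_poly[OF r, of "a + 1/2" N p "T_normalized p N n" K "jacobi_poly a n" c]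
      T_normalized_eq_jacobi_poly[of _ p N n]
    unfolding K_def F_def P_def t_def a_def by (simp add: algebra_simps)
  also have "\<dots> = K * F * (4 * (- (real n * (real n + a + 1)) * P n)
      - ((a + 1/2) * (a + 3/2) + c\<^sup>2 * r\<^sup>2) * P n)"
    unfolding jacobi_poly_differential_equation P_def ..
  also have "\<dots> = K * F * (- chi p N n * P n - c\<^sup>2 * (r\<^sup>2 * P n))"
    unfolding chi_def a_def by (simp add: field_simps)
  also have "r\<^sup>2 * P n = real n * (real n + a) / (t * (t + 1)) * P (n - 1)
      + (a\<^sup>2 / (2 * t * (t + 2)) + 1/2) * P n
      + (real n + 1) * (real n + 1 + a) / ((t + 1) * (t + 2)) * P (n + 1)"
    using jacobi_poly_three_term[of a "r\<^sup>2" m] a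
    unfolding P_def t_def n by (simp add: add_ac)
  finally have L: "L_op p N c (T_normalized p N n) r = K * F * (- chi p N n * P n - c\<^sup>2 *
     (real n * (real n + a) / (t * (t + 1)) * P (n - 1)
      + (a\<^sup>2 / (2 * t * (t + 2)) + 1/2) * P n
      + (real n + 1) * (real n + 1 + a) / ((t + 1) * (t + 2)) * P (n + 1)))" .

  have nz: "t \<noteq> 0" "t + 1 \<noteq> 0" "t + 2 \<noteq> 0" "sqrt (t - 1) \<noteq> 0" "sqrt (t + 1) \<noteq> 0" "sqrt (t + 3) \<noteq> 0"
    using t(1) by simp_all
  have K: "K = sqrt 2 * sqrt (t + 1)"
    unfolding K_def by (rule real_sqrt_mult)
  \<comment> \<open>One of the two factors \<open>sqrt (t + 1)\<close> hidden in \<open>t + 1\<close> cancels against the normalization.\<close>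
  have K_div: "K / (t + 1) = sqrt 2 / sqrt (t + 1)"
    unfolding K using t real_sqrt_mult_self[of "t + 1"] by (simp add: field_simps)
  have coeff_a: "coeff_a p c N n = - c\<^sup>2 * (real n + a) * real n / (t * sqrt (t + 1) * sqrt (t - 1))"
    unfolding coeff_a_def t_def a_def by (simp add: add_ac)
  have T_pred: "T_normalized p N (n - 1) r = sqrt 2 * sqrt (t - 1) * (F * P (n - 1))"
    unfolding T n t by (simp add: add_ac)
  have lower: "coeff_a p c N n * T_normalized p N (n - 1) r
      = - c\<^sup>2 * real n * (real n + a) / t * (K / (t + 1)) * F * P (n - 1)"
    unfolding coeff_a T_pred K_div using nz by (simp add: divide_simps)
  have middle: "coeff_b p c N n * T_normalized p N n r
      = (- c\<^sup>2 * (a\<^sup>2 / (2 * t * (t + 2)) + 1/2) - chi p N n) * K * F * P n"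
    unfolding coeff_b_def T K t_def a_def by (simp add: add_ac algebra_simps)
  have coeff_c: "coeff_c p c N n
      = - c\<^sup>2 * (real n + 1 + a) * (real n + 1) / ((t + 2) * sqrt (t + 3) * sqrt (t + 1))"
    unfolding coeff_c_def t_def a_def by (simp add: add_ac)
  have T_succ: "T_normalized p N (n + 1) r = sqrt 2 * sqrt (t + 3) * (F * P (n + 1))"
    unfolding T t_def by (simp add: add_ac)
  have upper: "coeff_c p c N n * T_normalized p N (n + 1) r
      = - c\<^sup>2 * (real n + 1) * (real n + 1 + a) / (t + 2) * (K / (t + 1)) * F * P (n + 1)"
    unfolding coeff_c T_succ K_div using nz by (simp add: divide_simps)
  show ?thesis
    unfolding L lower middle upper using nz by (simp add: divide_simps) algebra
qed

end
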